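(* Let $K_4^-$ denote the 3-graph on vertex set $[4]$ with edge set $\{123,124,134\}$ and let $F_{3,2}=([5],\{123,124,125,345\})$. For each $n$, let $m(n)$ be the maximum number of edges of a 3-graph $G$ on $n$ vertices that contains no copy of $F_{3,2}$ as a subgraph and no 4-element vertex subset spanning exactly 3 edges (i.e. no induced copy of $K_4^-$). Then \[\lim_{n\to\infty}\frac{m(n)}{\binom n3}=\frac38.\]
   Context: A 3-graph $G=(V,E)$ consists of a vertex set $V$ and a set $E$ of 3-element subsets of $V$; $xyz$ abbreviates $\{x,y,z\}$. A set $S\subseteq V$ spans $k$ edges if exactly $k$ edges of $G$ are contained in $S$. The limit of $m(n)/\binom n3$ exists. *)

theory Defs
  imports Complex_Main
begin

text \<open>A hypergraph is a pair of a vertex set and an edge set.\<close>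

type_synonym 'a hgraph = "'a set \<times> 'a set set"

abbreviation verts :: "'a hgraph \<Rightarrow> 'a set" where "verts \<equiv> fst"

abbreviation edges :: "'a hgraph \<Rightarrow> 'a set set" where "edges \<equiv> snd"

definition three_graph :: "'a hgraph \<Rightarrow> bool" where
  "three_graph G \<longleftrightarrow> finite (verts G) \<and> (\<forall>e\<in>edges G. e \<subseteq> verts G \<and> card e = 3)"

text \<open>Copies as (not necessarily induced) subgraphs.\<close>

definition contains_copy :: "'b hgraph \<Rightarrow> 'a hgraph \<Rightarrow> bool" where
  "contains_copy H G \<longleftrightarrow>
     (\<exists>f. inj_on f (verts H) \<and> f ` verts H \<subseteq> verts G \<and> (\<forall>e\<in>edges H. f ` e \<in> edges G))"

definition contains_induced_copy :: "'b hgraph \<Rightarrow> 'a hgraph \<Rightarrow> bool" where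
  "contains_induced_copy H G \<longleftrightarrow>
     (\<exists>f. inj_on f (verts H) \<and> f ` verts H \<subseteq> verts G \<and>
        (\<forall>e. e \<subseteq> verts H \<longrightarrow> (e \<in> edges H \<longleftrightarrow> f ` e \<in> edges G)))"

definition spanned_edges :: "'a hgraph \<Rightarrow> 'a set \<Rightarrow> nat" where
  "spanned_edges G S = card {e \<in> edges G. e \<subseteq> S}"

definition K4_minus :: "nat hgraph" where
  "K4_minus = ({1..4}, {{1,2,3}, {1,2,4}, {1,3,4}})"

definition F32 :: "nat hgraph" where
  "F32 = ({1..5}, {{1,2,3}, {1,2,4}, {1,2,5}, {3,4,5}})"

definition admissible :: "'a hgraph \<Rightarrow> bool" where
  "admissible G \<longleftrightarrow> three_graph G \<and> \<not> contains_copy F32 G \<and>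
     \<not> (\<exists>S. S \<subseteq> verts G \<and> card S = 4 \<and> spanned_edges G S = 3)"

text \<open>Every 3-graph on \<open>n\<close> vertices is isomorphic to one with vertices in \<open>nat\<close>, so
  restricting to this vertex type loses nothing.\<close>

definition max_edges :: "nat \<Rightarrow> nat" where
  "max_edges n = Max {card (edges G) | G :: nat hgraph. admissible G \<and> card (verts G) = n}"

text \<open>The set in the preceding definition is finite and nonempty, so \<open>Max\<close> is an honest maximum.\<close>

lemma finite_edge_counts:
  "finite {card (edges G) | G :: nat hgraph. admissible G \<and> card (verts G) = n}"
proof (rule finite_subset)
  show "{card (edges G) | G :: nat hgraph. admissible G \<and> card (verts G) = n} \<subseteq> {..2 ^ n}"
  proof
    fix k assume "k \<in> {card (edges G) | G :: nat hgraph. admissible G \<and> card (verts G) = n}"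
    then obtain G :: "nat hgraph"
      where G: "k = card (edges G)" "admissible G" "card (verts G) = n" by blast
    hence V: "finite (verts G)" "edges G \<subseteq> Pow (verts G)"
      by (auto simp: admissible_def three_graph_def)
    have "card (edges G) \<le> card (Pow (verts G))"
      using V by (intro card_mono) auto
    thus "k \<in> {..2 ^ n}"
      using V G by (simp add: card_Pow)
  qed
qed simp

lemma edge_counts_nonempty:
  "{card (edges G) | G :: nat hgraph. admissible G \<and> card (verts G) = n} \<noteq> {}"
proof -
  have "admissible ({..<n}, {})"
    by (auto simp: admissible_def three_graph_def contains_copy_def spanned_edges_def F32_def)
  thus ?thesis by fastforce
qed

text \<open>Four vertices spanning exactly three edges are the same as an induced copy of \<open>K4_minus\<close>.\<close>

lemma three_subset_of_four:
  assumes "card S = 4" "e \<subseteq> S" "card e = 3"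
  shows "\<exists>x\<in>S. e = S - {x}"
proof -
  have fin: "finite S" using assms(1) by (metis card.infinite zero_neq_numeral)
  have "card (S - e) = 1"
    using assms fin by (simp add: card_Diff_subset finite_subset)
  then obtain x where "S - e = {x}" by (auto simp: card_1_singleton_iff)
  thus ?thesis using assms(2) by blast
qed

lemma K4_minus_edges:
  assumes "e \<subseteq> {1..4::nat}"
  shows "e \<in> edges K4_minus \<longleftrightarrow> card e = 3 \<and> e \<noteq> {2,3,4}"
proof -
  have V: "{1..4::nat} = {1,2,3,4}" by auto
  show ?thesis
  proof
    assume "card e = 3 \<and> e \<noteq> {2,3,4}"
    moreover have "\<exists>i\<in>{1..4}. e = {1..4} - {i}" if "card e = 3"
      using three_subset_of_four[OF _ assms that] by simp
    ultimately obtain i where "i \<in> {1,2,3,4}" "e = {1,2,3,4} - {i}" "e \<noteq> {2,3,4}"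
      unfolding V by blast
    thus "e \<in> edges K4_minus"
      by (elim insertE emptyE) (simp_all add: K4_minus_def insert_Diff_if)
  qed (auto simp: K4_minus_def)
qed

lemma spans_three_iff_induced_K4_minus:
  assumes "three_graph G"
  shows "(\<exists>S. S \<subseteq> verts G \<and> card S = 4 \<and> spanned_edges G S = 3) \<longleftrightarrow>
         contains_induced_copy K4_minus G"
proof
  assume "\<exists>S. S \<subseteq> verts G \<and> card S = 4 \<and> spanned_edges G S = 3"
  then obtain S where S: "S \<subseteq> verts G" "card S = 4" "spanned_edges G S = 3" by blast
  have fin: "finite S" using S(2) by (metis card.infinite zero_neq_numeral)
  have E: "{e \<in> edges G. e \<subseteq> S} = (\<lambda>x. S - {x}) ` {x \<in> S. S - {x} \<in> edges G}"
  proof (intro equalityI subsetI)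
    fix e assume e: "e \<in> {e \<in> edges G. e \<subseteq> S}"
    hence "card e = 3" using assms by (auto simp: three_graph_def)
    then obtain x where "x \<in> S" "e = S - {x}"
      using three_subset_of_four[OF S(2)] e by blast
    thus "e \<in> (\<lambda>x. S - {x}) ` {x \<in> S. S - {x} \<in> edges G}" using e by blast
  qed auto
  have "inj_on (\<lambda>x. S - {x}) {x \<in> S. S - {x} \<in> edges G}"
    by (auto simp: inj_on_def)
  hence "card {x \<in> S. S - {x} \<in> edges G} = 3"
    using S(3) unfolding spanned_edges_def E by (simp add: card_image)
  then obtain x where x: "x \<in> S" "{x \<in> S. S - {x} \<in> edges G} = S - {x}"
    using three_subset_of_four[OF S(2), of "{x \<in> S. S - {x} \<in> edges G}"] by blast
  have "card (S - {x}) = card {2..4::nat}" using x S(2) fin by simp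
  then obtain h where h: "bij_betw h {2..4::nat} (S - {x})"
    using finite_same_card_bij[of "{2..4::nat}" "S - {x}"] fin by auto
  define f where "f = h(1 := x)"
  have V: "{1..4::nat} = insert 1 {2..4}" by auto
  have fb: "f ` {2..4} = S - {x}" "f 1 = x"
    using h by (auto simp: f_def bij_betw_def)
  have inj: "inj_on f {1..4}"
    using h unfolding V by (auto simp: f_def bij_betw_def inj_on_def)
  have im: "f ` {1..4} = S" unfolding V using fb x by auto
  have "e \<in> edges K4_minus \<longleftrightarrow> f ` e \<in> edges G" if e: "e \<subseteq> {1..4}" for e
  proof (cases "card e = 3")
    case True
    then obtain i where i: "i \<in> {1..4}" "e = {1..4} - {i}"
      using three_subset_of_four[OF _ e] by auto
    have fe: "f ` e = S - {f i}"
      using inj i im by (simp add: inj_on_image_set_diff)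
    have "f i \<in> S" using i im by auto
    hence "f ` e \<in> edges G \<longleftrightarrow> f i \<noteq> x" using x unfolding fe by blast
    also have "\<dots> \<longleftrightarrow> i \<noteq> 1"
      using inj i fb(2) by (auto simp: inj_on_def)
    also have "\<dots> \<longleftrightarrow> e \<noteq> {2,3,4}"
    proof -
      have "{2,3,4::nat} = {1..4} - {1}" "(1::nat) \<in> {1..4}" by auto
      thus ?thesis using i by blast
    qed
    finally show ?thesis using True K4_minus_edges[OF e] by simp
  next
    case False
    have "card (f ` e) = card e"
      using inj e by (meson card_image inj_on_subset)
    thus ?thesis using False K4_minus_edges[OF e] assms by (auto simp: three_graph_def)
  qed
  thus "contains_induced_copy K4_minus G"
    using inj im S(1) unfolding contains_induced_copy_def by (intro exI[of _ f]) (simp add: K4_minus_def)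
next
  assume "contains_induced_copy K4_minus G"
  then obtain f where f: "inj_on f {1..4::nat}" "f ` {1..4} \<subseteq> verts G"
      "\<And>e. e \<subseteq> {1..4} \<Longrightarrow> e \<in> edges K4_minus \<longleftrightarrow> f ` e \<in> edges G"
    unfolding contains_induced_copy_def by (auto simp: K4_minus_def)
  define S where "S = f ` {1..4::nat}"
  have K: "edges K4_minus \<subseteq> Pow {1..4}" by (auto simp: K4_minus_def)
  have "{e \<in> edges G. e \<subseteq> S} = (\<lambda>e. f ` e) ` edges K4_minus"
  proof (intro equalityI subsetI)
    fix e assume "e \<in> {e \<in> edges G. e \<subseteq> S}"
    then obtain d where "d \<subseteq> {1..4}" "e = f ` d" "e \<in> edges G"
      unfolding S_def by (auto simp: subset_image_iff)
    thus "e \<in> (\<lambda>e. f ` e) ` edges K4_minus" using f(3) by blast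
  next
    fix e assume "e \<in> (\<lambda>e. f ` e) ` edges K4_minus"
    thus "e \<in> {e \<in> edges G. e \<subseteq> S}" using K f(3) unfolding S_def by blast
  qed
  moreover have "inj_on (\<lambda>e. f ` e) (edges K4_minus)"
    using inj_on_image_Pow[OF f(1)] K by (rule inj_on_subset)
  moreover have "card (edges K4_minus) = 3"
  proof -
    have "{1,2,3} \<noteq> {1,2,4::nat}" "{1,2,3} \<noteq> {1,3,4::nat}" "{1,2,4} \<noteq> {1,3,4::nat}"
      unfolding set_eq_iff insert_iff empty_iff by presburger+
    thus ?thesis by (simp add: K4_minus_def)
  qed
  ultimately have "spanned_edges G S = 3"
    by (simp add: spanned_edges_def card_image)
  moreover have "card S = 4" using f(1) by (simp add: S_def card_image)
  ultimately show "\<exists>S. S \<subseteq> verts G \<and> card S = 4 \<and> spanned_edges G S = 3"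
    using f(2) S_def by blast
qed

end

theory Submission
  imports Defs "HOL-Library.List_Lexorder" "HOL-Library.Multiset" "HOL-Real_Asymp.Real_Asymp"
begin

text \<open>
  The lower bound is the complete 4-partite 3-graph. The upper bound is a flag algebra argument on
  six vertices. Both forbidden configurations have every pair of vertices covered by an edge, so
  neither is created by a blow-up of an admissible graph; hence one may average over all 6-tuples of
  vertices, repetitions included, and obtain the sharp bound \<open>16 |E| \<le> n\<^sup>3\<close> without error terms.
  The average of a suitable weight \<open>324 - 216 \<cdot> (edges) - (sums of squares)\<close> over the labellings of a
  6-tuple is nonnegative for every admissible edge pattern, which is a finite check.
  The squares come from two rooted types: four roots spanning exactly two edges, extended by one
  vertex (seven squares), and two roots, extended by two vertices (two squares). Their
  coefficients were found by rounding a solution of the corresponding semidefinite program.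
\<close>

section \<open>The certificate on six vertices\<close>

definition four_ok :: "bool \<Rightarrow> bool \<Rightarrow> bool \<Rightarrow> bool \<Rightarrow> bool" where
  "four_ok p q r s \<longleftrightarrow> \<not> (p \<and> q \<and> r \<and> \<not> s) \<and> \<not> (p \<and> q \<and> \<not> r \<and> s) \<and> \<not> (p \<and> \<not> q \<and> r \<and> s)
    \<and> \<not> (\<not> p \<and> q \<and> r \<and> s)"

text \<open>
  The argument \<open>xijk\<close> says whether \<open>ijk\<close> is an edge. The first five conjuncts are the condition on
  4-sets; the others forbid the copies of \<open>F32\<close>, one for each choice of the pair of vertices
  that lies in three edges.
\<close>

definition five_ok :: "bool \<Rightarrow> bool \<Rightarrow> bool \<Rightarrow> bool \<Rightarrow> bool \<Rightarrow> bool \<Rightarrow> bool \<Rightarrow> bool \<Rightarrow> bool \<Rightarrow> bool \<Rightarrow> bool"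
  where
  "five_ok x012 x013 x023 x123 x014 x024 x124 x034 x134 x234 \<longleftrightarrow>
     four_ok x012 x013 x023 x123 \<and>
     four_ok x012 x014 x024 x124 \<and>
     four_ok x013 x014 x034 x134 \<and>
     four_ok x023 x024 x034 x234 \<and>
     four_ok x123 x124 x134 x234 \<and>
     \<not> (x012 \<and> x013 \<and> x014 \<and> x234) \<and>
     \<not> (x012 \<and> x023 \<and> x024 \<and> x134) \<and>
     \<not> (x013 \<and> x023 \<and> x034 \<and> x124) \<and>
     \<not> (x014 \<and> x024 \<and> x034 \<and> x123) \<and>
     \<not> (x012 \<and> x123 \<and> x124 \<and> x034) \<and>
     \<not> (x013 \<and> x123 \<and> x134 \<and> x024) \<and>
     \<not> (x014 \<and> x124 \<and> x134 \<and> x023) \<and>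
     \<not> (x023 \<and> x123 \<and> x234 \<and> x014) \<and>
     \<not> (x024 \<and> x124 \<and> x234 \<and> x013) \<and>
     \<not> (x034 \<and> x134 \<and> x234 \<and> x012)"

text \<open>
  For roots \<open>1, 2, 3, 4\<close> with edges \<open>123\<close> and \<open>124\<close> only, and a further vertex \<open>v\<close>, the argument
  \<open>bij\<close> says whether \<open>ijv\<close> is an edge. The first three components change sign when \<open>1, 2\<close> or
  \<open>3, 4\<close> are exchanged, the last four do not. Patterns that do not occur get the value zero.
\<close>

definition flag_vector :: "bool \<Rightarrow> bool \<Rightarrow> bool \<Rightarrow> bool \<Rightarrow> bool \<Rightarrow> bool \<Rightarrow> int list" where
  "flag_vector b12 b13 b14 b23 b24 b34 =
     (if b12 then if b34 then [0, 0, 0, 0, 0, 0, 0] else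
        (case (b13, b14, b23, b24) of
           (False, False, False, False) \<Rightarrow> [0, 0, 0, 0, -2, -1, 0]
         | (True, False, True, False) \<Rightarrow> [0, 0, 0, 0, -1, -2, 1]
         | (False, True, False, True) \<Rightarrow> [0, 0, 0, 0, -1, -2, 1]
         | (True, True, True, True) \<Rightarrow> [0, 0, 0, -2, 2, -1, -2]
         | _ \<Rightarrow> [0, 0, 0, 0, 0, 0, 0])
      else if b34 then
        (case (b13, b14, b23, b24) of
           (False, False, False, False) \<Rightarrow> [0, 0, 0, 0, 0, 1, 0]
         | (True, False, False, False) \<Rightarrow> [0, 2, 2, 0, 0, 0, 1]
         | (False, False, False, True) \<Rightarrow> [0, 2, 2, 0, 0, 0, 1]
         | (False, True, False, False) \<Rightarrow> [0, -2, -2, 0, 0, 0, 1]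
         | (False, False, True, False) \<Rightarrow> [0, -2, -2, 0, 0, 0, 1]
         | (True, False, False, True) \<Rightarrow> [1, 1, 2, 0, 1, 1, -1]
         | (False, True, True, False) \<Rightarrow> [-1, -1, -2, 0, 1, 1, -1]
         | _ \<Rightarrow> [0, 0, 0, 0, 0, 0, 0])
      else
        (case (b13, b14, b23, b24) of
           (False, False, False, False) \<Rightarrow> [0, 0, 0, 0, 1, 1, 1]
         | (True, False, False, False) \<Rightarrow> [0, 0, 1, 0, 0, 0, 1]
         | (False, False, False, True) \<Rightarrow> [0, 0, 1, 0, 0, 0, 1]
         | (False, True, False, False) \<Rightarrow> [0, 0, -1, 0, 0, 0, 1]
         | (False, False, True, False) \<Rightarrow> [0, 0, -1, 0, 0, 0, 1]
         | (True, True, False, False) \<Rightarrow> [0, 0, 0, 1, 0, 1, 1]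
         | (False, False, True, True) \<Rightarrow> [0, 0, 0, 1, 0, 1, 1]
         | (True, False, False, True) \<Rightarrow> [1, 2, 1, 0, 1, 1, -2]
         | (False, True, True, False) \<Rightarrow> [-1, -2, -1, 0, 1, 1, -2]
         | _ \<Rightarrow> [0, 0, 0, 0, 0, 0, 0]))"

fun weighted_dot :: "int list \<Rightarrow> int list \<Rightarrow> int list \<Rightarrow> int" where
  "weighted_dot (w # ws) (x # xs) (y # ys) = w * x * y + weighted_dot ws xs ys"
| "weighted_dot _ _ _ = 0"

text \<open>Roots of any other type contribute nothing. The list holds the coefficients of the seven
  squares.\<close>

definition type_product :: "bool \<Rightarrow> bool \<Rightarrow> bool \<Rightarrow> bool \<Rightarrow> int list \<Rightarrow> int list \<Rightarrow> int" where
  "type_product p q r s xs ys = (if p \<and> q \<and> \<not> r \<and> \<not> s then weighted_dot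
    [720, 12, 60, 168, 79, 26, 108] xs ys else 0)"

text \<open>
  Roots \<open>x, y\<close> and further vertices \<open>u, v\<close>; the arguments refer to \<open>xyu\<close>, \<open>xyv\<close>, \<open>xuv\<close>, \<open>yuv\<close>.
\<close>

fun even_form :: "bool \<Rightarrow> bool \<Rightarrow> bool \<Rightarrow> bool \<Rightarrow> int" where
  "even_form False False False False = -3"
| "even_form False False True False = -2"
| "even_form False False False True = -2"
| "even_form False False True True = 5"
| "even_form True True True True = 6"
| "even_form _ _ _ _ = 0"

fun odd_form :: "bool \<Rightarrow> bool \<Rightarrow> bool \<Rightarrow> bool \<Rightarrow> int" where
  "odd_form True False True False = 1"
| "odd_form False True True False = 1"
| "odd_form True False False True = -1"
| "odd_form False True False True = -1"
| "odd_form _ _ _ _ = 0"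

definition root_product :: "bool \<Rightarrow> bool \<Rightarrow> bool \<Rightarrow> bool \<Rightarrow> bool \<Rightarrow> bool \<Rightarrow> bool \<Rightarrow> bool \<Rightarrow> int" where
  "root_product p q r s p' q' r' s' =
     12 * even_form p q r s * even_form p' q' r' s'
       + 253 * odd_form p q r s * odd_form p' q' r' s'"

text \<open>
  For a pair \<open>u, v\<close> and the other four vertices \<open>a, b, c, d\<close>: \<open>px\<close>, \<open>qxy\<close>, \<open>rxy\<close>, \<open>sxyz\<close> refer to
  \<open>uvx\<close>, \<open>uxy\<close>, \<open>vxy\<close>, \<open>xyz\<close>. The pair \<open>u, v\<close> serves as the two extensions of the six ways in
  which \<open>a, b, c, d\<close> can be a type, and as the two roots of the three splittings into pairs.
\<close>

definition weight :: "bool \<Rightarrow> bool \<Rightarrow> bool \<Rightarrow> bool \<Rightarrow> bool \<Rightarrow> bool \<Rightarrow> bool \<Rightarrow> bool \<Rightarrow> bool \<Rightarrow> bool \<Rightarrow> bool \<Rightarrow>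
  bool \<Rightarrow> bool \<Rightarrow> bool \<Rightarrow> bool \<Rightarrow> bool \<Rightarrow> bool \<Rightarrow> bool \<Rightarrow> bool \<Rightarrow> bool \<Rightarrow> int" where
  "weight pa pb pc pd qab qac qad qbc qbd qcd rab rac rad rbc rbd rcd sabc sabd sacd sbcd =
     324 - 216 * (of_bool pa + of_bool pb + of_bool pc + of_bool pd)
     - type_product sabc sabd sacd sbcd (flag_vector qab qac qad qbc qbd qcd)
       (flag_vector rab rac rad rbc rbd rcd)
     - type_product sabc sacd sabd sbcd (flag_vector qac qab qad qbc qcd qbd)
       (flag_vector rac rab rad rbc rcd rbd)
     - type_product sabd sacd sabc sbcd (flag_vector qad qab qac qbd qcd qbc)
       (flag_vector rad rab rac rbd rcd rbc)
     - type_product sabc sbcd sabd sacd (flag_vector qbc qab qbd qac qcd qad)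
       (flag_vector rbc rab rbd rac rcd rad)
     - type_product sabd sbcd sabc sacd (flag_vector qbd qab qbc qad qcd qac)
       (flag_vector rbd rab rbc rad rcd rac)
     - type_product sacd sbcd sabc sabd (flag_vector qcd qac qbc qad qbd qab)
       (flag_vector rcd rac rbc rad rbd rab)
     - root_product pa pb qab rab pc pd qcd rcd
     - root_product pa pc qac rac pb pd qbd rbd
     - root_product pa pd qad rad pb pc qbc rbc"

definition six_weight :: "bool \<Rightarrow> bool \<Rightarrow> bool \<Rightarrow> bool \<Rightarrow> bool \<Rightarrow> bool \<Rightarrow> bool \<Rightarrow> bool \<Rightarrow> bool \<Rightarrow> bool \<Rightarrow>
  bool \<Rightarrow> bool \<Rightarrow> bool \<Rightarrow> bool \<Rightarrow> bool \<Rightarrow> bool \<Rightarrow> bool \<Rightarrow> bool \<Rightarrow> bool \<Rightarrow> bool \<Rightarrow> int" where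
  "six_weight x012 x013 x023 x123 x014 x024 x124 x034 x134 x234 x015 x025 x125 x035 x135 x235 x045
    x145 x245 x345 =
     weight x012 x013 x014 x015 x023 x024 x025 x034 x035 x045 x123 x124 x125 x134 x135 x145 x234
       x235 x245 x345 +
     weight x012 x023 x024 x025 x013 x014 x015 x034 x035 x045 x123 x124 x125 x234 x235 x245 x134
       x135 x145 x345 +
     weight x013 x023 x034 x035 x012 x014 x015 x024 x025 x045 x123 x134 x135 x234 x235 x345 x124
       x125 x145 x245 +
     weight x014 x024 x034 x045 x012 x013 x015 x023 x025 x035 x124 x134 x145 x234 x245 x345 x123
       x125 x135 x235 +
     weight x015 x025 x035 x045 x012 x013 x014 x023 x024 x034 x125 x135 x145 x235 x245 x345 x123
       x124 x134 x234 +
     weight x012 x123 x124 x125 x013 x014 x015 x134 x135 x145 x023 x024 x025 x234 x235 x245 x034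
       x035 x045 x345 +
     weight x013 x123 x134 x135 x012 x014 x015 x124 x125 x145 x023 x034 x035 x234 x235 x345 x024
       x025 x045 x245 +
     weight x014 x124 x134 x145 x012 x013 x015 x123 x125 x135 x024 x034 x045 x234 x245 x345 x023
       x025 x035 x235 +
     weight x015 x125 x135 x145 x012 x013 x014 x123 x124 x134 x025 x035 x045 x235 x245 x345 x023
       x024 x034 x234 +
     weight x023 x123 x234 x235 x012 x024 x025 x124 x125 x245 x013 x034 x035 x134 x135 x345 x014
       x015 x045 x145 +
     weight x024 x124 x234 x245 x012 x023 x025 x123 x125 x235 x014 x034 x045 x134 x145 x345 x013
       x015 x035 x135 +
     weight x025 x125 x235 x245 x012 x023 x024 x123 x124 x234 x015 x035 x045 x135 x145 x345 x013
       x014 x034 x134 +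
     weight x034 x134 x234 x345 x013 x023 x035 x123 x135 x235 x014 x024 x045 x124 x145 x245 x012
       x015 x025 x125 +
     weight x035 x135 x235 x345 x013 x023 x034 x123 x134 x234 x015 x025 x045 x125 x145 x245 x012
       x014 x024 x124 +
     weight x045 x145 x245 x345 x014 x024 x034 x124 x134 x234 x015 x025 x035 x125 x135 x235 x012
       x013 x023 x123"

text \<open>
  Patterns list the triples in colexicographic order, so the pattern on the first four or five
  vertices is a prefix of the whole pattern. To keep the check short, only patterns are considered
  that are lexicographically maximal among those obtained by exchanging consecutive vertices.
\<close>

fun maximal4 :: "bool list \<Rightarrow> bool" where
  "maximal4 [x012, x013, x023, x123] \<longleftrightarrow>
     four_ok x012 x013 x023 x123 \<and>
     [x012, x013, x123, x023] \<le> [x012, x013, x023, x123] \<and>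
     [x012, x023, x013, x123] \<le> [x012, x013, x023, x123] \<and>
     [x013, x012, x023, x123] \<le> [x012, x013, x023, x123]"
| "maximal4 _ \<longleftrightarrow> False"

fun maximal5 :: "bool list \<Rightarrow> bool" where
  "maximal5 [x012, x013, x023, x123, x014, x024, x124, x034, x134, x234] \<longleftrightarrow>
     five_ok x012 x013 x023 x123 x014 x024 x124 x034 x134 x234 \<and>
     [x012, x013, x123, x023, x014, x124, x024, x134, x034, x234]
       \<le> [x012, x013, x023, x123, x014, x024, x124, x034, x134, x234] \<and>
     [x012, x023, x013, x123, x024, x014, x124, x034, x234, x134]
       \<le> [x012, x013, x023, x123, x014, x024, x124, x034, x134, x234] \<and>
     [x013, x012, x023, x123, x014, x034, x134, x024, x124, x234]
       \<le> [x012, x013, x023, x123, x014, x024, x124, x034, x134, x234] \<and>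
     [x012, x014, x024, x124, x013, x023, x123, x034, x134, x234]
       \<le> [x012, x013, x023, x123, x014, x024, x124, x034, x134, x234]"
| "maximal5 _ \<longleftrightarrow> False"

text \<open>Sixteen entries determine every triple inside the vertices 0, 1, 2, 3, 5, so this 5-set
  can be tested before branching on the triples that contain both 4 and 5.\<close>

fun partial6 :: "bool list \<Rightarrow> bool" where
  "partial6 [x012, x013, x023, x123, x014, x024, x124, x034, x134, x234, x015, x025, x125, x035,
    x135, x235] \<longleftrightarrow>
     five_ok x012 x013 x023 x123 x015 x025 x125 x035 x135 x235"
| "partial6 _ \<longleftrightarrow> False"

text \<open>The 5-sets omitting 5 or 4 are the business of \<open>maximal5\<close> and
  \<open>partial6\<close>; the four others become testable only here.\<close>

fun maximal6 :: "bool list \<Rightarrow> bool" where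
  "maximal6 [x012, x013, x023, x123, x014, x024, x124, x034, x134, x234, x015, x025, x125, x035,
    x135, x235, x045, x145, x245, x345] \<longleftrightarrow>
     five_ok x123 x124 x134 x234 x125 x135 x235 x145 x245 x345 \<and>
     five_ok x023 x024 x034 x234 x025 x035 x235 x045 x245 x345 \<and>
     five_ok x013 x014 x034 x134 x015 x035 x135 x045 x145 x345 \<and>
     five_ok x012 x014 x024 x124 x015 x025 x125 x045 x145 x245 \<and>
     [x012, x013, x123, x023, x014, x124, x024, x134, x034, x234, x015, x125, x025, x135, x035,
       x235, x145, x045, x245, x345] \<le> [x012, x013, x023, x123, x014, x024, x124, x034, x134, x234,
       x015, x025, x125, x035, x135, x235, x045, x145, x245, x345] \<and>
     [x012, x023, x013, x123, x024, x014, x124, x034, x234, x134, x025, x015, x125, x035, x235,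
       x135, x045, x245, x145, x345] \<le> [x012, x013, x023, x123, x014, x024, x124, x034, x134, x234,
       x015, x025, x125, x035, x135, x235, x045, x145, x245, x345] \<and>
     [x013, x012, x023, x123, x014, x034, x134, x024, x124, x234, x015, x035, x135, x025, x125,
       x235, x045, x145, x345, x245] \<le> [x012, x013, x023, x123, x014, x024, x124, x034, x134, x234,
       x015, x025, x125, x035, x135, x235, x045, x145, x245, x345] \<and>
     [x012, x014, x024, x124, x013, x023, x123, x034, x134, x234, x015, x025, x125, x045, x145,
       x245, x035, x135, x235, x345] \<le> [x012, x013, x023, x123, x014, x024, x124, x034, x134, x234,
       x015, x025, x125, x035, x135, x235, x045, x145, x245, x345] \<and>
     [x012, x013, x023, x123, x015, x025, x125, x035, x135, x235, x014, x024, x124, x034, x134,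
       x234, x045, x145, x245, x345] \<le> [x012, x013, x023, x123, x014, x024, x124, x034, x134, x234,
       x015, x025, x125, x035, x135, x235, x045, x145, x245, x345]"
| "maximal6 _ \<longleftrightarrow> False"

fun nonneg6 :: "bool list \<Rightarrow> bool" where
  "nonneg6 [x012, x013, x023, x123, x014, x024, x124, x034, x134, x234, x015, x025, x125, x035,
    x135, x235, x045, x145, x245, x345] \<longleftrightarrow>
     0 \<le> six_weight x012 x013 x023 x123 x014 x024 x124 x034 x134 x234 x015 x025 x125 x035 x135 x235
       x045 x145 x245 x345"
| "nonneg6 _ \<longleftrightarrow> False"

text \<open>
  The search is written without bound variables because \<open>code_simp\<close> would otherwise rewrite the
  bodies of the quantifiers symbolically. The disjunctions below are evaluated from the left.
\<close>

definition both :: "(bool list \<Rightarrow> bool) \<Rightarrow> bool list \<Rightarrow> bool" where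
  "both P xs \<longleftrightarrow> P (xs @ [True]) \<and> P (xs @ [False])"

definition "stage6 xs \<longleftrightarrow> \<not> maximal6 xs \<or> nonneg6 xs"

definition "stage5a xs \<longleftrightarrow> \<not> partial6 xs \<or> both (both (both (both stage6))) xs"

definition "stage5 xs \<longleftrightarrow> \<not> maximal5 xs \<or> both (both (both (both (both (both stage5a))))) xs"

definition "stage4 xs \<longleftrightarrow> \<not> maximal4 xs \<or> both (both (both (both (both (both stage5))))) xs"

text \<open>The twenty bits are set in groups of 4, 6, 6, 4: triples inside the first four vertices,
  triples with the fifth, triples of the sixth with two of the first four, triples containing the
  last two. A failed test discards all completions at once.\<close>

lemma certificate_holds: "both (both (both (both stage4))) []" by code_simp

section \<open>Nonnegativity of the weight\<close>

lemma length_flag_vector: "length (flag_vector a b c d f g) = 7"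
  by (simp add: flag_vector_def split: prod.splits bool.splits)

definition flip :: "int list \<Rightarrow> int list" where
  "flip xs = map2 (*) [-1, -1, -1, 1, 1, 1, 1] xs"

lemma flag_vector_swap12: "flag_vector a d f b c g = flip (flag_vector a b c d f g)"
  by (cases a; cases b; cases c; cases d; cases f; cases g)
    (simp_all add: flag_vector_def flip_def)

lemma flag_vector_swap34: "flag_vector a c b f d g = flip (flag_vector a b c d f g)"
  by (cases a; cases b; cases c; cases d; cases f; cases g)
    (simp_all add: flag_vector_def flip_def)

lemma length7: "length xs = 7 \<longleftrightarrow> (\<exists>a b c d f g h. xs = [a, b, c, d, f, g, h])"
  by (auto simp: numeral_eq_Suc length_Suc_conv)

text \<open>Each sign enters both factors and cancels, so the antisymmetric components do no harm to
  the symmetry of the weight.\<close>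

lemma type_product_flip:
  assumes "length xs = 7" "length ys = 7"
  shows "type_product p q r s (flip xs) (flip ys) = type_product p q r s xs ys"
  using assms by (auto simp: length7 type_product_def flip_def)

lemma type_product_commute: "type_product p q r s xs ys = type_product p q r s ys xs"
proof -
  have "weighted_dot ws xs ys = weighted_dot ws ys xs" for ws
    by (induction ws xs ys rule: weighted_dot.induct) (auto simp: mult_ac weighted_dot.simps(2-))
  thus ?thesis by (simp add: type_product_def)
qed

text \<open>Exchanging the first two roots permutes the two absent triples of the type; exchanging
  the last two permutes the two present ones.\<close>

lemma type_product_swap12: "type_product p q s r xs ys = type_product p q r s xs ys"
  and type_product_swap34: "type_product q p r s xs ys = type_product p q r s xs ys"
  by (auto simp: type_product_def)

lemma even_form_swap: "even_form q p r s = even_form p q r s"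
  "even_form p q s r = even_form p q r s"
  by (cases p; cases q; cases r; cases s; simp)+

lemma odd_form_swap: "odd_form q p r s = odd_form p q r s"
  "odd_form p q s r = - odd_form p q r s"
  by (cases p; cases q; cases r; cases s; simp)+

text \<open>The odd form changes sign in both factors.\<close>

lemma root_product_swap_root: "root_product p q s r p' q' s' r' = root_product p q r s p' q' r' s'"
  unfolding root_product_def even_form_swap(2) [of p q s] even_form_swap(2) [of p' q' s']
    odd_form_swap(2) [of p q s] odd_form_swap(2) [of p' q' s'] by simp

lemma root_product_swap_leaf: "root_product q p r s p' q' r' s' = root_product p q r s p' q' r' s'"
  unfolding root_product_def even_form_swap(1) [of q] odd_form_swap(1) [of q] ..

text \<open>No distinctness is assumed: the axioms cover repeated vertices as well, which is how
  closure under blow-ups enters.\<close>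

locale sparse_triples =
  fixes e :: "'a \<Rightarrow> 'a \<Rightarrow> 'a \<Rightarrow> bool"
  assumes sym12: "e a b c = e b a c" and sym23: "e a b c = e a c b"
    and quad: "four_ok (e a b c) (e a b d) (e a c d) (e b c d)"
    and F32_free: "\<not> (e a b c \<and> e a b d \<and> e a b f \<and> e c d f)"
begin

lemmas e_sym = sym12 sym23

section \<open>Symmetry of the weight under relabelling of the vertices\<close>

definition flag :: "'a \<Rightarrow> 'a \<Rightarrow> 'a \<Rightarrow> 'a \<Rightarrow> 'a \<Rightarrow> int list" where
  "flag a b c d v = flag_vector (e a b v) (e a c v) (e a d v) (e b c v) (e b d v) (e c d v)"

definition type_term where
  "type_term a b c d u v = type_product (e a b c) (e a b d) (e a c d) (e b c d) (flag a b c d u)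
    (flag a b c d v)"

definition root_term where
  "root_term x y u v w z = root_product (e x y u) (e x y v) (e x u v) (e y u v) (e x y w) (e x y z)
    (e x w z) (e y w z)"

definition pair_weight where
  "pair_weight u v a b c d =
     324 - 216 * (of_bool (e u v a) + of_bool (e u v b) + of_bool (e u v c) + of_bool (e u v d))
     - (type_term a b c d u v + type_term a c b d u v + type_term a d b c u v + type_term b c a d u
       v + type_term b d a c u v + type_term c d a b u v)
     - (root_term u v a b c d + root_term u v a c b d + root_term u v a d b c)"

text \<open>Symmetries are proved on the vertex form; the certificate evaluates the Boolean
  form.\<close>

lemma pair_weight_eq_weight:
  "pair_weight u v a b c d = weight (e u v a) (e u v b) (e u v c) (e u v d)
     (e u a b) (e u a c) (e u a d) (e u b c) (e u b d) (e u c d)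
     (e v a b) (e v a c) (e v a d) (e v b c) (e v b d) (e v c d)
     (e a b c) (e a b d) (e a c d) (e b c d)"
  unfolding pair_weight_def weight_def type_term_def root_term_def flag_def by (simp add: e_sym)

lemma flag_swap12: "flag b a c d w = flip (flag a b c d w)"
proof -
  have "flag b a c d w = flag_vector (e a b w) (e b c w) (e b d w) (e a c w) (e a d w) (e c d w)"
    unfolding flag_def by (simp only: e_sym)
  also have "\<dots> = flip (flag a b c d w)"
    unfolding flag_def by (rule flag_vector_swap12)
  finally show ?thesis .
qed

lemma flag_swap34: "flag a b d c w = flip (flag a b c d w)"
proof -
  have "flag a b d c w = flag_vector (e a b w) (e a d w) (e a c w) (e b d w) (e b c w) (e c d w)"
    unfolding flag_def by (simp only: e_sym)
  also have "\<dots> = flip (flag a b c d w)"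
    unfolding flag_def by (rule flag_vector_swap34)
  finally show ?thesis .
qed

lemma length_flag: "length (flag a b c d w) = 7"
  by (simp add: flag_def length_flag_vector)

lemma type_term_swap12: "type_term b a c d u v = type_term a b c d u v"
proof -
  have "type_term b a c d u v = type_product (e a b c) (e a b d) (e b c d) (e a c d)
    (flag b a c d u) (flag b a c d v)"
    unfolding type_term_def by (simp only: e_sym)
  also have "\<dots> = type_term a b c d u v"
    unfolding flag_swap12 [of b a] type_product_flip [OF length_flag length_flag] type_term_def
      by (rule type_product_swap12)
  finally show ?thesis .
qed

lemma type_term_swap34: "type_term a b d c u v = type_term a b c d u v"
proof -
  have "type_term a b d c u v = type_product (e a b d) (e a b c) (e a c d) (e b c d)
    (flag a b d c u) (flag a b d c v)"
    unfolding type_term_def by (simp only: e_sym)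
  also have "\<dots> = type_term a b c d u v"
    unfolding flag_swap34 [of a b d c] type_product_flip [OF length_flag length_flag] type_term_def
      by (rule type_product_swap34)
  finally show ?thesis .
qed

lemma type_term_commute: "type_term a b c d v u = type_term a b c d u v"
  unfolding type_term_def by (rule type_product_commute)

lemmas type_term_swap = type_term_swap12 type_term_swap34 type_term_commute

lemma root_term_swap_root: "root_term y x u v w z = root_term x y u v w z"
proof -
  have "root_term y x u v w z = root_product (e x y u) (e x y v) (e y u v) (e x u v) (e x y w)
    (e x y z) (e y w z) (e x w z)"
    unfolding root_term_def by (simp only: e_sym)
  also have "\<dots> = root_term x y u v w z" unfolding root_term_def by (rule root_product_swap_root)
  finally show ?thesis .
qed

lemma root_term_swap_leaf: "root_term x y v u w z = root_term x y u v w z"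
proof -
  have "root_term x y v u w z = root_product (e x y v) (e x y u) (e x u v) (e y u v) (e x y w)
    (e x y z) (e x w z) (e y w z)"
    unfolding root_term_def by (simp only: e_sym)
  also have "\<dots> = root_term x y u v w z" unfolding root_term_def by (rule root_product_swap_leaf)
  finally show ?thesis .
qed

lemma root_term_swap_pairs: "root_term x y w z u v = root_term x y u v w z"
  by (simp add: root_term_def root_product_def)

lemma root_term_swap_leaf2: "root_term x y u v z w = root_term x y u v w z"
  by (subst (1 2) root_term_swap_pairs) (rule root_term_swap_leaf)

lemmas root_term_swap = root_term_swap_root root_term_swap_leaf root_term_swap_leaf2
  root_term_swap_pairs

text \<open>Each exchange permutes the six type terms among themselves, and likewise the three root
  terms.\<close>

lemma pair_weight_swap: "pair_weight v u a b c d = pair_weight u v a b c d"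
  "pair_weight u v b a c d = pair_weight u v a b c d"
  "pair_weight u v a c b d = pair_weight u v a b c d"
  "pair_weight u v a b d c = pair_weight u v a b c d"
  unfolding pair_weight_def by (simp_all only: e_sym type_term_swap root_term_swap add_ac)

text \<open>Since \<open>pair_weight\<close> is symmetric in its first two and in its last four
  arguments, these 15 choices of a pair represent all 720 orderings.\<close>

definition total_weight where
  "total_weight x0 x1 x2 x3 x4 x5 = pair_weight x0 x1 x2 x3 x4 x5 + pair_weight x0 x2 x1 x3 x4 x5
    + pair_weight x0 x3 x1 x2 x4 x5 + pair_weight x0 x4 x1 x2 x3 x5 + pair_weight x0 x5 x1 x2 x3 x4
    + pair_weight x1 x2 x0 x3 x4 x5 + pair_weight x1 x3 x0 x2 x4 x5
    + pair_weight x1 x4 x0 x2 x3 x5 + pair_weight x1 x5 x0 x2 x3 x4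
    + pair_weight x2 x3 x0 x1 x4 x5 + pair_weight x2 x4 x0 x1 x3 x5
    + pair_weight x2 x5 x0 x1 x3 x4 + pair_weight x3 x4 x0 x1 x2 x5
    + pair_weight x3 x5 x0 x1 x2 x4 + pair_weight x4 x5 x0 x1 x2 x3"

lemma total_weight_eq_six_weight: "total_weight x0 x1 x2 x3 x4 x5
  = six_weight (e x0 x1 x2) (e x0 x1 x3) (e x0 x2 x3) (e x1 x2 x3) (e x0 x1 x4) (e x0 x2 x4)
  (e x1 x2 x4) (e x0 x3 x4) (e x1 x3 x4) (e x2 x3 x4) (e x0 x1 x5) (e x0 x2 x5) (e x1 x2 x5)
  (e x0 x3 x5) (e x1 x3 x5) (e x2 x3 x5) (e x0 x4 x5) (e x1 x4 x5) (e x2 x4 x5) (e x3 x4 x5)"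
  unfolding total_weight_def six_weight_def pair_weight_eq_weight by (simp only: e_sym)

lemma total_weight_swap: "total_weight x1 x0 x2 x3 x4 x5 = total_weight x0 x1 x2 x3 x4 x5"
  "total_weight x0 x2 x1 x3 x4 x5 = total_weight x0 x1 x2 x3 x4 x5"
  "total_weight x0 x1 x3 x2 x4 x5 = total_weight x0 x1 x2 x3 x4 x5"
  "total_weight x0 x1 x2 x4 x3 x5 = total_weight x0 x1 x2 x3 x4 x5"
  "total_weight x0 x1 x2 x3 x5 x4 = total_weight x0 x1 x2 x3 x4 x5"
  unfolding total_weight_def by (simp_all only: pair_weight_swap add_ac)

end

section \<open>Reduction to lexicographically maximal labellings\<close>

text \<open>Bubble sort: the head of \<open>xs\<close> is carried to the front of \<open>ys\<close>
  by adjacent exchanges, and the induction hypothesis for \<open>f\<close> with this head prepended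
  treats the tails.\<close>

lemma adjacent_swaps_mset:
  assumes swap: "\<And>us a b vs. f (us @ a # b # vs) = f (us @ b # a # vs)" and "mset xs = mset ys"
  shows "f xs = f ys"
  using assms
proof (induction xs arbitrary: f ys)
  case (Cons x xs)
  have "x \<in> set ys" using Cons.prems(2) by (metis list.set_intros(1) set_mset_mset)
  then obtain us vs where ys: "ys = us @ x # vs" by (meson split_list)
  have front: "f (us @ x # vs) = f (x # us @ vs)" for vs
  proof (induction us arbitrary: vs rule: rev_induct)
    case (snoc u us)
    show ?case using Cons.prems(1) [of us u x vs] snoc [of "u # vs"] by simp
  qed simp
  have "f (x # xs) = f (x # us @ vs)"
  proof (rule Cons.IH [of "\<lambda>zs. f (x # zs)"])
    show "f (x # us @ a # b # vs) = f (x # us @ b # a # vs)" for us a b vs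
      using Cons.prems(1) [of "x # us"] by simp
    show "mset xs = mset (us @ vs)" using Cons.prems(2) ys by simp
  qed
  thus ?case using front ys by simp
qed simp

text \<open>Lets maximality of a full pattern descend to the prefixes tested earlier in the
  search.\<close>

lemma take_le: "xs \<le> ys \<Longrightarrow> take n xs \<le> take n (ys :: 'b :: linorder list)"
proof (induction n arbitrary: xs ys)
  case (Suc n)
  thus ?case by (cases xs; cases ys) auto
qed simp

lemma both4: "both (both (both (both P))) xs \<Longrightarrow> P (xs @ [a, b, c, d])"
  by (cases a; cases b; cases c; cases d) (simp_all add: both_def)

lemma both6: "both (both (both (both (both (both P))))) xs \<Longrightarrow> P (xs @ [a, b, c, d, f, g])"
  by (cases a; cases b; cases c; cases d; cases f; cases g) (simp_all add: both_def)

lemma length6: "length xs = 6 \<longleftrightarrow> (\<exists>a b c d f g. xs = [a, b, c, d, f, g])"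
  by (auto simp: numeral_eq_Suc length_Suc_conv)

context sparse_triples
begin

lemma five_ok:
  "five_ok (e a b c) (e a b d) (e a c d) (e b c d) (e a b f) (e a c f) (e b c f) (e a d f)
    (e b d f) (e c d f)"
proof -
  have q: "four_ok (e a b c) (e a b d) (e a c d) (e b c d)" for a b c d by (rule quad)
  have F: "\<not> (e x y u \<and> e x y v \<and> e x y w \<and> e u v w)" for x y u v w by (rule F32_free)
  show ?thesis
    unfolding five_ok_def
    using q [of a b c d] q [of a b c f] q [of a b d f] q [of a c d f] q [of b c d f]
      F [of a b c d f] F [of a c b d f] F [of a d b c f] F [of a f b c d]
      F [of b c a d f] F [of b d a c f] F [of b f a c d] F [of c d a b f] F [of c f a b d] F
        [of d f a b c]
    by (simp only: e_sym simp_thms)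
qed

text \<open>The value zero at other lengths makes exchange invariance true for all lists, as
  \<open>adjacent_swaps_mset\<close> demands.\<close>

fun list_weight :: "'a list \<Rightarrow> int" where
  "list_weight [x0, x1, x2, x3, x4, x5] = total_weight x0 x1 x2 x3 x4 x5"
| "list_weight _ = 0"

fun profile :: "'a list \<Rightarrow> bool list" where
  "profile [y0, y1, y2, y3, y4, y5] = [e y0 y1 y2, e y0 y1 y3, e y0 y2 y3, e y1 y2 y3, e y0 y1 y4,
    e y0 y2 y4, e y1 y2 y4, e y0 y3 y4, e y1 y3 y4, e y2 y3 y4, e y0 y1 y5, e y0 y2 y5, e y1 y2 y5,
    e y0 y3 y5, e y1 y3 y5, e y2 y3 y5, e y0 y4 y5, e y1 y4 y5, e y2 y4 y5, e y3 y4 y5]"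
| "profile _ = []"

lemma list_weight_mset: "mset xs = mset ys \<Longrightarrow> list_weight xs = list_weight ys"
proof (rule adjacent_swaps_mset [of list_weight])
  fix us vs :: "'a list" and a b
  show "list_weight (us @ a # b # vs) = list_weight (us @ b # a # vs)"
  proof (cases "length (us @ a # b # vs) = 6")
    case True
    hence "length us + length vs = 4" by simp
    hence "length us = 0 \<and> length vs = 4 \<or> length us = 1 \<and> length vs = 3 \<or>
      length us = 2 \<and> length vs = 2 \<or> length us = 3 \<and> length vs = 1 \<or>
      length us = 4 \<and> length vs = 0" by arith
    thus ?thesis
      by (elim disjE) (auto simp: numeral_eq_Suc length_Suc_conv total_weight_swap)
  next
    case False
    have "length zs = 6" if "list_weight zs \<noteq> 0" for zs
      using that by (cases zs rule: list_weight.cases) auto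
    thus ?thesis using False by (metis length_append length_Cons)
  qed
qed

text \<open>A maximal labelling of an allowed configuration passes every pruning test, so the search
  reaches its pattern and has checked its weight.\<close>

lemma total_weight_nonneg_lex_max:
  assumes max: "\<And>zs. mset zs = mset [y0, y1, y2, y3, y4, y5] \<Longrightarrow>
    profile zs \<le> profile [y0, y1, y2, y3, y4, y5]"
  shows "0 \<le> total_weight y0 y1 y2 y3 y4 y5"
proof -
  have swaps: "profile [y1, y0, y2, y3, y4, y5] \<le> profile [y0, y1, y2, y3, y4, y5]"
    "profile [y0, y2, y1, y3, y4, y5] \<le> profile [y0, y1, y2, y3, y4, y5]"
    "profile [y0, y1, y3, y2, y4, y5] \<le> profile [y0, y1, y2, y3, y4, y5]"
    "profile [y0, y1, y2, y4, y3, y5] \<le> profile [y0, y1, y2, y3, y4, y5]"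
    "profile [y0, y1, y2, y3, y5, y4] \<le> profile [y0, y1, y2, y3, y4, y5]"
    by (rule max; simp add: add_mset_commute)+
  note [simp del] = Cons_le_Cons
  \<comment> \<open>An exchange among the first four vertices permutes the first four entries among
    themselves, so cutting both sides to length 4 compares patterns on these vertices. Length 10
    does the same for five vertices.\<close>
  have m4: "maximal4 [e y0 y1 y2, e y0 y1 y3, e y0 y2 y3, e y1 y2 y3]"
    using swaps(1-3) [THEN take_le [where n = 4]] by (simp add: quad e_sym)
  have m5: "maximal5 [e y0 y1 y2, e y0 y1 y3, e y0 y2 y3, e y1 y2 y3, e y0 y1 y4, e y0 y2 y4, e y1
    y2 y4, e y0 y3 y4, e y1 y3 y4, e y2 y3 y4]"
    using swaps(1-4) [THEN take_le [where n = 10]] by (simp add: five_ok e_sym)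
  have p6: "partial6 [e y0 y1 y2, e y0 y1 y3, e y0 y2 y3, e y1 y2 y3, e y0 y1 y4, e y0 y2 y4, e y1
    y2 y4, e y0 y3 y4, e y1 y3 y4, e y2 y3 y4, e y0 y1 y5, e y0 y2 y5, e y1 y2 y5, e y0 y3 y5, e y1
    y3 y5, e y2 y3 y5]"
    by (simp add: five_ok)
  have m6: "maximal6 [e y0 y1 y2, e y0 y1 y3, e y0 y2 y3, e y1 y2 y3, e y0 y1 y4, e y0 y2 y4, e y1
    y2 y4, e y0 y3 y4, e y1 y3 y4, e y2 y3 y4, e y0 y1 y5, e y0 y2 y5, e y1 y2 y5, e y0 y3 y5, e y1
    y3 y5, e y2 y3 y5, e y0 y4 y5, e y1 y4 y5, e y2 y4 y5, e y3 y4 y5]"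
    using swaps by (simp add: five_ok e_sym)
  have "stage4 [e y0 y1 y2, e y0 y1 y3, e y0 y2 y3, e y1 y2 y3]"
    using both4 [OF certificate_holds] by simp
  with m4 have "both (both (both (both (both (both stage5)))))
    [e y0 y1 y2, e y0 y1 y3, e y0 y2 y3, e y1 y2 y3]" by (simp add: stage4_def)
  from both6 [OF this] have "stage5 [e y0 y1 y2, e y0 y1 y3, e y0 y2 y3, e y1 y2 y3, e y0 y1 y4, e
    y0 y2 y4, e y1 y2 y4, e y0 y3 y4, e y1 y3 y4, e y2 y3 y4]" by simp
  with m5 have "both (both (both (both (both (both stage5a)))))
    [e y0 y1 y2, e y0 y1 y3, e y0 y2 y3, e y1 y2 y3, e y0 y1 y4, e y0 y2 y4, e y1 y2 y4, e y0 y3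
    y4, e y1 y3 y4, e y2 y3 y4]" by (simp add: stage5_def)
  from both6 [OF this] have "stage5a [e y0 y1 y2, e y0 y1 y3, e y0 y2 y3, e y1 y2 y3, e y0 y1 y4, e
    y0 y2 y4, e y1 y2 y4, e y0 y3 y4, e y1 y3 y4, e y2 y3 y4, e y0 y1 y5, e y0 y2 y5, e y1 y2 y5, e
    y0 y3 y5, e y1 y3 y5, e y2 y3 y5]" by simp
  with p6 have "both (both (both (both stage6)))
    [e y0 y1 y2, e y0 y1 y3, e y0 y2 y3, e y1 y2 y3, e y0 y1 y4, e y0 y2 y4, e y1 y2 y4, e y0 y3
    y4, e y1 y3 y4, e y2 y3 y4, e y0 y1 y5, e y0 y2 y5, e y1 y2 y5, e y0 y3 y5, e y1 y3 y5, e y2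
    y3 y5]" by (simp add: stage5a_def)
  from both4 [OF this] have "stage6 [e y0 y1 y2, e y0 y1 y3, e y0 y2 y3, e y1 y2 y3, e y0 y1 y4, e
    y0 y2 y4, e y1 y2 y4, e y0 y3 y4, e y1 y3 y4, e y2 y3 y4, e y0 y1 y5, e y0 y2 y5, e y1 y2 y5, e
    y0 y3 y5, e y1 y3 y5, e y2 y3 y5, e y0 y4 y5, e y1 y4 y5, e y2 y4 y5, e y3 y4 y5]" by simp
  with m6 show ?thesis by (simp add: stage6_def total_weight_eq_six_weight)
qed

text \<open>Among the finitely many rearrangements one has the largest profile, and rearranging does
  not change the total weight.\<close>

lemma total_weight_nonneg: "0 \<le> total_weight x0 x1 x2 x3 x4 x5"
proof -
  let ?xs = "[x0, x1, x2, x3, x4, x5]"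
  let ?A = "{ys. mset ys = mset ?xs}"
  have fin: "finite ?A" by (rule mset_eq_finite)
  have "Max (profile ` ?A) \<in> profile ` ?A" using fin by (intro Max_in) (auto intro: exI [of _ ?xs])
  then obtain ys where ys: "mset ys = mset ?xs" "Max (profile ` ?A) = profile ys" by auto
  have "length ys = 6" using ys(1) by (simp flip: size_mset)
  then obtain a b c d f g where abc: "ys = [a, b, c, d, f, g]" by (auto simp: length6)
  have "profile zs \<le> profile ys" if "mset zs = mset ys" for zs
  proof -
    have "profile zs \<in> profile ` ?A" using that ys(1) by auto
    thus ?thesis using fin ys(2) Max_ge [of "profile ` ?A" "profile zs"] by simp
  qed
  hence "0 \<le> total_weight a b c d f g" unfolding abc by (rule total_weight_nonneg_lex_max)
  thus ?thesis using list_weight_mset [OF ys(1)] by (simp add: abc)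
qed

end

section \<open>Averaging over tuples of vertices\<close>

definition tuple_sum :: "'a set \<Rightarrow> ('a \<Rightarrow> 'a \<Rightarrow> 'a \<Rightarrow> 'a \<Rightarrow> 'a \<Rightarrow> 'a \<Rightarrow> int) \<Rightarrow> int" where
  "tuple_sum V g = (\<Sum>a\<in>V. \<Sum>b\<in>V. \<Sum>c\<in>V. \<Sum>d\<in>V. \<Sum>u\<in>V. \<Sum>v\<in>V. g a b c d u v)"

lemma sum_lists_Suc:
  fixes f :: "'a list \<Rightarrow> int"
  shows "(\<Sum>xs | set xs \<subseteq> V \<and> length xs = Suc n. f xs) =
    (\<Sum>x\<in>V. \<Sum>xs | set xs \<subseteq> V \<and> length xs = n. f (x # xs))"
proof -
  have "(\<Sum>xs | set xs \<subseteq> V \<and> length xs = Suc n. f xs) =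
      (\<Sum>(xs, x)\<in>{xs. set xs \<subseteq> V \<and> length xs = n} \<times> V. f (x # xs))"
    unfolding lists_length_Suc_eq
    by (subst sum.reindex) (auto simp: inj_on_def case_prod_unfold)
  also have "\<dots> = (\<Sum>xs | set xs \<subseteq> V \<and> length xs = n. \<Sum>x\<in>V. f (x # xs))"
    by (simp add: sum.cartesian_product)
  also have "\<dots> = (\<Sum>x\<in>V. \<Sum>xs | set xs \<subseteq> V \<and> length xs = n. f (x # xs))"
    by (rule sum.swap)
  finally show ?thesis .
qed

lemma tuple_sum_lists:
  "tuple_sum V g =
     (\<Sum>xs | set xs \<subseteq> V \<and> length xs = 6. g (xs ! 0) (xs ! 1) (xs ! 2) (xs ! 3) (xs ! 4) (xs ! 5))"
proof -
  have z: "{xs. set xs \<subseteq> V \<and> length xs = 0} = {[]}" by auto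
  have "6 = Suc (Suc (Suc (Suc (Suc (Suc 0)))))" by simp
  thus ?thesis by (simp only: sum_lists_Suc z) (simp add: tuple_sum_def)
qed

text \<open>Six indices covering six positions form a permutation. Reindexing is then an injection
  of a finite set of lists into itself, hence a bijection.\<close>

lemma tuple_sum_permute:
  assumes V: "finite V" and ms: "{i0, i1, i2, i3, i4, i5} = {0, 1, 2, 3, 4, 5}"
  shows "(\<Sum>xs | set xs \<subseteq> V \<and> length xs = 6.
      g (xs ! i0) (xs ! i1) (xs ! i2) (xs ! i3) (xs ! i4) (xs ! i5)) = tuple_sum V g"
proof -
  let ?is = "[i0, i1, i2, i3, i4, i5]"
  let ?L = "{xs. set xs \<subseteq> V \<and> length xs = 6}"
  let ?h = "\<lambda>xs. map ((!) xs) ?is"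
  have iset: "set ?is = {..<6}" using ms by (simp only: list.set) auto
  have fin: "finite ?L" using V by (rule finite_lists_length_eq)
  have sub: "?h ` ?L \<subseteq> ?L"
  proof (rule image_subsetI)
    fix xs assume "xs \<in> ?L"
    hence "(!) xs ` set ?is \<subseteq> V" unfolding iset by (auto simp: subset_iff)
    hence "set (?h xs) \<subseteq> V" by (simp only: set_map)
    thus "?h xs \<in> ?L" by simp
  qed
  have inj: "inj_on ?h ?L"
  proof (rule inj_onI)
    fix xs ys assume "xs \<in> ?L" "ys \<in> ?L" "?h xs = ?h ys"
    moreover from this have "xs ! i = ys ! i" if "i < 6" for i
      using iset that by (metis lessThan_iff map_eq_conv)
    ultimately show "xs = ys" by (simp add: nth_equalityI)
  qed
  have "?h ` ?L = ?L" by (rule endo_inj_surj [OF fin sub inj])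
  hence "tuple_sum V g = (\<Sum>xs\<in>?h ` ?L. g (xs ! 0) (xs ! 1) (xs ! 2) (xs ! 3) (xs ! 4) (xs ! 5))"
    by (simp add: tuple_sum_lists)
  also have "\<dots> = (\<Sum>xs\<in>?L. g (xs ! i0) (xs ! i1) (xs ! i2) (xs ! i3) (xs ! i4) (xs ! i5))"
    by (subst sum.reindex [OF inj]) simp
  finally show ?thesis ..
qed

section \<open>Positivity of the squares and the density bound\<close>

text \<open>With \<open>u\<close> and \<open>v\<close> independent, each coordinate contributes its
  weight times the square of its sum over \<open>V\<close>; the induction peels off one coordinate
  at a time.\<close>

lemma weighted_dot_sum_nonneg:
  assumes "\<And>w. w \<in> set ws \<Longrightarrow> 0 \<le> w" and "\<And>u. u \<in> V \<Longrightarrow> length (h u) = length ws"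
  shows "0 \<le> (\<Sum>u\<in>V. \<Sum>v\<in>V. weighted_dot ws (h u) (h v))"
  using assms
proof (induction ws arbitrary: h)
  case (Cons w ws)
  have *: "weighted_dot (w # ws) (h u) (h v) = w * (hd (h u) * hd (h v))
    + weighted_dot ws (tl (h u)) (tl (h v))"
    if "u \<in> V" "v \<in> V" for u v
    using Cons.prems(2) [OF that(1)] Cons.prems(2) [OF that(2)] by (cases "h u"; cases "h v") auto
  have "(\<Sum>u\<in>V. \<Sum>v\<in>V. weighted_dot (w # ws) (h u) (h v)) =
      (\<Sum>u\<in>V. \<Sum>v\<in>V. w * (hd (h u) * hd (h v)))
        + (\<Sum>u\<in>V. \<Sum>v\<in>V. weighted_dot ws (tl (h u)) (tl (h v)))"
    by (simp only: * sum.distrib cong: sum.cong)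
  also have "(\<Sum>u\<in>V. \<Sum>v\<in>V. w * (hd (h u) * hd (h v))) = w * (\<Sum>u\<in>V. hd (h u))\<^sup>2"
    by (simp add: power2_eq_square flip: sum_distrib_left sum_distrib_right)
  finally have "(\<Sum>u\<in>V. \<Sum>v\<in>V. weighted_dot (w # ws) (h u) (h v)) =
      w * (\<Sum>u\<in>V. hd (h u))\<^sup>2 + (\<Sum>u\<in>V. \<Sum>v\<in>V. weighted_dot ws (tl (h u)) (tl (h v)))" .
  moreover have "0 \<le> (\<Sum>u\<in>V. \<Sum>v\<in>V. weighted_dot ws (tl (h u)) (tl (h v)))"
    using Cons.prems by (intro Cons.IH [of "\<lambda>u. tl (h u)"]) auto
  ultimately show ?case using Cons.prems(1) [of w] by simp
qed simp

context sparse_triples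
begin

text \<open>Whether the roots have the right type does not depend on \<open>u\<close> and
  \<open>v\<close>, so for fixed roots the inner sum is a sum of squares or zero.\<close>

lemma type_term_sum_nonneg: "0 \<le> tuple_sum V type_term"
  unfolding tuple_sum_def
proof (rule sum_nonneg, rule sum_nonneg, rule sum_nonneg, rule sum_nonneg)
  fix a b c d
  show "0 \<le> (\<Sum>u\<in>V. \<Sum>v\<in>V. type_term a b c d u v)"
  proof (cases "e a b c \<and> e a b d \<and> \<not> e a c d \<and> \<not> e b c d")
    case True
    hence "type_term a b c d u v = weighted_dot [720, 12, 60, 168, 79, 26, 108] (flag a b c d u)
      (flag a b c d v)" for u v
      by (simp add: type_term_def type_product_def)
    thus ?thesis by (simp only:) (intro weighted_dot_sum_nonneg; auto simp: length_flag)
  next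
    case False
    hence "type_term a b c d u v = 0" for u v by (auto simp: type_term_def type_product_def)
    thus ?thesis by simp
  qed
qed

lemma root_term_sum_nonneg: "0 \<le> tuple_sum V root_term"
  unfolding tuple_sum_def
proof (rule sum_nonneg, rule sum_nonneg)
  fix x y
  let ?E = "\<lambda>u v. even_form (e x y u) (e x y v) (e x u v) (e y u v)"
  let ?O = "\<lambda>u v. odd_form (e x y u) (e x y v) (e x u v) (e y u v)"
  have "(\<Sum>u\<in>V. \<Sum>v\<in>V. \<Sum>w\<in>V. \<Sum>z\<in>V. root_term x y u v w z) =
      12 * (\<Sum>u\<in>V. \<Sum>v\<in>V. ?E u v)\<^sup>2 + 253 * (\<Sum>u\<in>V. \<Sum>v\<in>V. ?O u v)\<^sup>2"
    unfolding root_term_def root_product_def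
    by (simp add: sum.distrib mult.assoc power2_eq_square flip: sum_distrib_left sum_distrib_right)
  thus "0 \<le> (\<Sum>u\<in>V. \<Sum>v\<in>V. \<Sum>w\<in>V. \<Sum>z\<in>V. root_term x y u v w z)" by simp
qed

text \<open>Each of the four edge indicators leaves three vertices free, whence
  \<open>card V ^ 3\<close> and 864 = 4 * 216. The squares are dropped.\<close>

lemma pair_weight_sum:
  assumes "finite V"
  shows "tuple_sum V pair_weight \<le> 324 * int (card V) ^ 6 - 864 * int (card V) ^ 3 *
    (\<Sum>a\<in>V. \<Sum>b\<in>V. \<Sum>c\<in>V. of_bool (e a b c))"
proof -
  let ?L = "{xs. set xs \<subseteq> V \<and> length xs = 6}"
  let ?g = "\<lambda>a b c d u v. of_bool (e a b c) :: int"
  note perm = tuple_sum_permute [OF assms]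
  have e: "tuple_sum V ?g = int (card V) ^ 3 * (\<Sum>a\<in>V. \<Sum>b\<in>V. \<Sum>c\<in>V. of_bool (e a b c))"
    by (simp add: tuple_sum_def sum_distrib_left power3_eq_cube mult.assoc)
  have "tuple_sum V pair_weight = (\<Sum>xs\<in>?L. 324) - 216 * (4 * tuple_sum V ?g) - 6 * tuple_sum V
    type_term - 3 * tuple_sum V root_term"
    unfolding tuple_sum_lists [of V pair_weight] pair_weight_def sum_subtractf sum.distrib
      sum_distrib_left [symmetric]
    by (simp add: perm [where g = type_term] perm [where g = root_term] insert_commute
       perm [of 0 "Suc 0" 2 3 4 5 ?g] perm [of 0 "Suc 0" 3 2 4 5 ?g]
       perm [of 0 "Suc 0" 4 2 3 5 ?g] perm [of 0 "Suc 0" 5 2 3 4 ?g])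
  also have "(\<Sum>xs\<in>?L. 324) = 324 * int (card V) ^ 6"
    using card_lists_length_eq [OF assms, of 6] by simp
  finally show ?thesis using e type_term_sum_nonneg [of V] root_term_sum_nonneg [of V]
    by (simp add: algebra_simps)
qed

lemma total_weight_sum:
  assumes "finite V"
  shows "tuple_sum V total_weight = 15 * tuple_sum V pair_weight"
proof -
  note perm = tuple_sum_permute [OF assms, where g = pair_weight]
  show ?thesis
    unfolding tuple_sum_lists [of V total_weight] total_weight_def sum.distrib
    by (simp add: perm insert_commute)
qed

text \<open>The sum of a nonnegative weight is nonnegative; for nonempty \<open>V\<close> the common
  factor 108 times \<open>card V ^ 3\<close> cancels.\<close>

lemma edge_density:
  assumes "finite V"
  shows "8 * (\<Sum>a\<in>V. \<Sum>b\<in>V. \<Sum>c\<in>V. of_bool (e a b c)) \<le> 3 * int (card V) ^ 3"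
proof (cases "V = {}")
  case False
  let ?n = "int (card V)" and ?T = "\<Sum>a\<in>V. \<Sum>b\<in>V. \<Sum>c\<in>V. of_bool (e a b c) :: int"
  have n: "0 < ?n" using assms False by (simp add: card_gt_0_iff)
  have "0 \<le> tuple_sum V total_weight" unfolding tuple_sum_def
    by (intro sum_nonneg total_weight_nonneg)
  hence "0 \<le> 324 * ?n ^ 6 - 864 * ?n ^ 3 * ?T" using pair_weight_sum [OF assms] total_weight_sum
    [OF assms] by simp
  also have "\<dots> = 108 * ?n ^ 3 * (3 * ?n ^ 3 - 8 * ?T)" by (simp add: algebra_simps flip: power_add)
  finally show ?thesis using n by (simp add: zero_le_mult_iff)
qed simp

end

section \<open>Admissible graphs\<close>

lemma card3_triple_iff: "card {a, b, c} = 3 \<longleftrightarrow> a \<noteq> b \<and> a \<noteq> c \<and> b \<noteq> c"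
  by (auto simp: card_insert_if)

definition edge_rel :: "'a hgraph \<Rightarrow> 'a \<Rightarrow> 'a \<Rightarrow> 'a \<Rightarrow> bool" where
  "edge_rel G a b c \<longleftrightarrow> {a, b, c} \<in> edges G"

lemma edge_rel_distinct:
  assumes "three_graph G" "edge_rel G a b c"
  shows "a \<noteq> b" "a \<noteq> c" "b \<noteq> c" "{a, b, c} \<subseteq> verts G"
proof -
  have "\<forall>t\<in>edges G. t \<subseteq> verts G \<and> card t = 3" and "{a, b, c} \<in> edges G"
    using assms by (simp_all add: three_graph_def edge_rel_def)
  hence *: "{a, b, c} \<subseteq> verts G \<and> card {a, b, c} = 3" by (rule bspec)
  hence V: "{a, b, c} \<subseteq> verts G" by (rule conjunct1)
  from * have "a \<noteq> b \<and> a \<noteq> c \<and> b \<noteq> c" unfolding card3_triple_iff by (rule conjunct2)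
  thus "a \<noteq> b" "a \<noteq> c" "b \<noteq> c" by blast+
  show "{a, b, c} \<subseteq> verts G" by (rule V)
qed

lemma edge_rel_sym: "edge_rel G a b c = edge_rel G b a c" "edge_rel G a b c = edge_rel G a c b"
  by (simp_all add: edge_rel_def insert_commute)

text \<open>The three triples cover every pair of the four vertices. Distinctness therefore follows
  from the hypotheses, and degenerate tuples need no separate treatment.\<close>

lemma three_of_four_edges:
  assumes G: "three_graph G" "\<And>S. S \<subseteq> verts G \<Longrightarrow> card S = 4 \<Longrightarrow> spanned_edges G S \<noteq> 3"
    and e: "edge_rel G a b c" "edge_rel G a b d" "edge_rel G a c d"
  shows "edge_rel G b c d"
proof (rule ccontr)
  assume n: "\<not> edge_rel G b c d"
  let ?S = "{a, b, c, d}"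
  have d: "a \<noteq> b" "a \<noteq> c" "a \<noteq> d" "b \<noteq> c" "b \<noteq> d" "c \<noteq> d"
    using edge_rel_distinct [OF G(1)] e by blast+
  have V: "?S \<subseteq> verts G" using edge_rel_distinct(4) [OF G(1)] e by blast
  have S: "card ?S = 4" using d by simp
  have "{t \<in> edges G. t \<subseteq> ?S} = {{a, b, c}, {a, b, d}, {a, c, d}}"
  proof
    show "{t \<in> edges G. t \<subseteq> ?S} \<subseteq> {{a, b, c}, {a, b, d}, {a, c, d}}"
    proof
      fix t assume "t \<in> {t \<in> edges G. t \<subseteq> ?S}"
      hence t: "t \<in> edges G" "t \<subseteq> ?S" by simp_all
      hence "card t = 3" using G(1) by (simp add: three_graph_def)
      from three_subset_of_four [OF S t(2) this]
      obtain x where x: "x \<in> ?S" "t = ?S - {x}" by (elim bexE)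
      have "?S - {a} = {b, c, d}" "?S - {b} = {a, c, d}" "?S - {c} = {a, b, d}" "?S - {d}
        = {a, b, c}"
        using d by auto
      thus "t \<in> {{a, b, c}, {a, b, d}, {a, c, d}}" using x t(1) n
        by (elim insertE emptyE) (simp_all add: edge_rel_def)
    qed
  qed (use e in \<open>auto simp: edge_rel_def\<close>)
  moreover have "{a, b, c} \<noteq> {a, b, d}" "{a, b, c} \<noteq> {a, c, d}" "{a, b, d} \<noteq> {a, c, d}"
    using d by auto
  ultimately have "spanned_edges G ?S = 3" by (simp add: spanned_edges_def)
  thus False using G(2) [OF V S] by simp
qed

text \<open>Again all ten pairs lie in one of the four edges, so the five vertices are distinct
  automatically.\<close>

lemma F32_copy:
  assumes "three_graph G" "edge_rel G a b c" "edge_rel G a b d" "edge_rel G a b f" "edge_rel G c d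
    f"
  shows "contains_copy F32 G"
proof -
  have d: "a \<noteq> b" "a \<noteq> c" "a \<noteq> d" "a \<noteq> f" "b \<noteq> c" "b \<noteq> d" "b \<noteq> f" "c \<noteq> d" "c \<noteq> f" "d \<noteq> f"
    using edge_rel_distinct [OF assms(1)] assms(2-) by blast+
  have "{a, b, c, d, f} \<subseteq> verts G" using edge_rel_distinct(4) [OF assms(1)] assms(2-) by blast
  have V: "{1..5::nat} = {1, 2, 3, 4, 5}" by auto
  let ?h = "\<lambda>i::nat. if i = 1 then a else if i = 2 then b else if i = 3 then c else if i
    = 4 then d else f"
  show ?thesis
    unfolding contains_copy_def F32_def fst_conv snd_conv V
    using assms(2-) d \<open>_ \<subseteq> verts G\<close> by (intro exI [of _ ?h])
      (auto simp: edge_rel_def insert_commute)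
qed

lemma F32_copyE:
  assumes "contains_copy F32 G"
  obtains a b c d f where "edge_rel G a b c" "edge_rel G a b d" "edge_rel G a b f" "edge_rel G c d
    f"
proof -
  from assms obtain h where "\<forall>t\<in>edges F32. h ` t \<in> edges G" by (auto simp: contains_copy_def)
  hence "edge_rel G (h 1) (h 2) (h 3)" "edge_rel G (h 1) (h 2) (h 4)" "edge_rel G (h 1) (h 2)
    (h 5)"
    "edge_rel G (h 3) (h 4) (h 5)" by (simp_all add: F32_def edge_rel_def)
  thus thesis by (rule that)
qed

lemma sparse_triples_edge_rel:
  assumes "admissible G"
  shows "sparse_triples (edge_rel G)"
proof
  from assms have G: "three_graph G" "\<And>S. S \<subseteq> verts G \<Longrightarrow> card S = 4 \<Longrightarrow> spanned_edges G S \<noteq> 3"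
    and F: "\<not> contains_copy F32 G" by (auto simp: admissible_def)
  fix a b c d f
  show "edge_rel G a b c = edge_rel G b a c" "edge_rel G a b c = edge_rel G a c b"
    by (rule edge_rel_sym)+
  show "four_ok (edge_rel G a b c) (edge_rel G a b d) (edge_rel G a c d) (edge_rel G b c d)"
    unfolding four_ok_def
    using three_of_four_edges [OF G, of a b c d] three_of_four_edges [OF G, of b a c d]
      three_of_four_edges [OF G, of c a b d] three_of_four_edges [OF G, of d a b c]
    by (simp only: edge_rel_sym) blast
  show "\<not> (edge_rel G a b c \<and> edge_rel G a b d \<and> edge_rel G a b f \<and> edge_rel G c d f)"
    using F32_copy [OF G(1)] F by blast
qed

text \<open>Every edge has at least six orderings, and different edges have disjoint sets of
  orderings.\<close>

lemma card_edges_le_ordered: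
  assumes G: "three_graph G"
  shows "6 * int (card (edges G)) \<le> (\<Sum>a\<in>verts G. \<Sum>b\<in>verts G. \<Sum>c\<in>verts G. of_bool
    (edge_rel G a b c))"
proof -
  let ?V = "verts G"
  let ?P = "\<lambda>t. {(a, b, c). {a, b, c} = t}"
  have V: "finite ?V" and E: "finite (edges G)"
    using G by (auto simp: three_graph_def intro: finite_subset [of _ "Pow ?V"])
  have sub: "?P t \<subseteq> t \<times> t \<times> t" for t :: "'a set" by auto
  have fin: "finite (?P t)" if "t \<in> edges G" for t
  proof -
    have "finite t" using that G V by (auto simp: three_graph_def intro: finite_subset)
    thus ?thesis by (intro finite_subset [OF sub] finite_cartesian_product)
  qed
  have six: "6 \<le> card (?P t)" if t: "t \<in> edges G" for t
  proof -
    obtain x y z where xyz: "t = {x, y, z}" "x \<noteq> y" "x \<noteq> z" "y \<noteq> z"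
      using t G by (auto simp: three_graph_def card_3_iff)
    have "card {(x,y,z), (x,z,y), (y,x,z), (y,z,x), (z,x,y), (z,y,x)} \<le> card (?P t)"
      by (rule card_mono [OF fin [OF t]]) (auto simp: xyz)
    thus ?thesis using xyz by simp
  qed
  let ?O = "{(a, b, c) \<in> ?V \<times> ?V \<times> ?V. edge_rel G a b c}"
  have "6 * card (edges G) \<le> (\<Sum>t\<in>edges G. card (?P t))"
    using sum_mono [of "edges G" "\<lambda>_. 6", OF six] by (simp add: mult.commute)
  moreover have "(\<Sum>t\<in>edges G. card (?P t)) = card (\<Union>t\<in>edges G. ?P t)"
  proof (rule card_UN_disjoint [symmetric])
    show "\<forall>t\<in>edges G. finite (?P t)" using fin by blast
    show "\<forall>t\<in>edges G. \<forall>t'\<in>edges G. t \<noteq> t' \<longrightarrow> ?P t \<inter> ?P t' = {}" by blast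
  qed (rule E)
  moreover have "card (\<Union>t\<in>edges G. ?P t) \<le> card ?O"
  proof (rule card_mono)
    show "finite ?O"
      by (rule finite_subset [of _ "?V \<times> ?V \<times> ?V"]) (use V in auto)
    show "(\<Union>t\<in>edges G. ?P t) \<subseteq> ?O"
    proof clarify
      fix a b c assume "{a, b, c} \<in> edges G"
      hence "edge_rel G a b c" by (simp add: edge_rel_def)
      with edge_rel_distinct(4) [OF G this]
      show "(a, b, c) \<in> ?V \<times> ?V \<times> ?V \<and> edge_rel G a b c" by simp
    qed
  qed
  moreover have "int (card ?O) = (\<Sum>p\<in>?V \<times> ?V \<times> ?V. of_bool
    (case p of (a, b, c) \<Rightarrow> edge_rel G a b c))"
  proof -
    have "?O = (?V \<times> ?V \<times> ?V) \<inter> {p. case p of (a, b, c) \<Rightarrow> edge_rel G a b c}" by auto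
    thus ?thesis using V by (simp add: sum_of_bool_eq)
  qed
  moreover have "\<dots> = (\<Sum>a\<in>?V. \<Sum>b\<in>?V. \<Sum>c\<in>?V. of_bool (edge_rel G a b c))"
    by (simp add: sum.cartesian_product case_prod_unfold)
  ultimately show ?thesis by linarith
qed

lemma admissible_card_edges:
  assumes "admissible G"
  shows "16 * card (edges G) \<le> card (verts G) ^ 3"
proof -
  interpret sparse_triples "edge_rel G" using assms by (rule sparse_triples_edge_rel)
  have G: "three_graph G" using assms by (simp add: admissible_def)
  hence "finite (verts G)" by (simp add: three_graph_def)
  from edge_density [OF this] card_edges_le_ordered [OF G]
  have "int (16 * card (edges G)) \<le> int (card (verts G) ^ 3)" by simp
  thus ?thesis by linarith
qed

section \<open>Lower bound from the complete 4-partite 3-graph\<close>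

definition four_partite :: "nat \<Rightarrow> nat hgraph" where
  "four_partite n = ({..<n}, {t. t \<subseteq> {..<n} \<and> card t = 3 \<and> inj_on (\<lambda>x. x mod 4) t})"

lemma edge_rel_four_partite:
  "edge_rel (four_partite n) a b c \<longleftrightarrow> a < n \<and> b < n \<and> c < n \<and>
     a mod 4 \<noteq> b mod 4 \<and> a mod 4 \<noteq> c mod 4 \<and> b mod 4 \<noteq> c mod 4"
  by (auto simp: edge_rel_def four_partite_def inj_on_def card3_triple_iff)

text \<open>A copy of \<open>F32\<close> would need five different residues mod 4. Three edges on
  four vertices force all their residues to differ, which makes the fourth triple an edge.\<close>

lemma four_partite_admissible: "admissible (four_partite n)"
  unfolding admissible_def
proof (intro conjI notI)
  show G: "three_graph (four_partite n)" by (auto simp: three_graph_def four_partite_def)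
  show False if "contains_copy F32 (four_partite n)"
    using that
  proof (rule F32_copyE)
    fix a b c d f
    assume "edge_rel (four_partite n) a b c" "edge_rel (four_partite n) a b d"
      "edge_rel (four_partite n) a b f" "edge_rel (four_partite n) c d f"
    hence "card {a mod 4, b mod 4, c mod 4, d mod 4, f mod 4} = 5"
      by (simp add: edge_rel_four_partite)
    moreover have "card {a mod 4, b mod 4, c mod 4, d mod 4, f mod 4} \<le> card {..<4::nat}"
      by (intro card_mono) auto
    ultimately show False by simp
  qed
  show False if S: "\<exists>S. S \<subseteq> verts (four_partite n) \<and> card S = 4 \<and> spanned_edges (four_partite n) S
    = 3"
  proof -
    from S [unfolded spans_three_iff_induced_K4_minus [OF G]] obtain h
      where h: "\<And>t. t \<subseteq> {1..4} \<Longrightarrow> t \<in> edges K4_minus \<longleftrightarrow> h ` t \<in> edges (four_partite n)"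
      unfolding contains_induced_copy_def by (auto simp: K4_minus_def)
    let ?e = "edge_rel (four_partite n)"
    have "?e (h 1) (h 2) (h 3)" "?e (h 1) (h 2) (h 4)" "?e (h 1) (h 3) (h 4)"
      using h [of "{1, 2, 3}"] h [of "{1, 2, 4}"] h [of "{1, 3, 4}"]
        by (auto simp: K4_minus_def edge_rel_def)
    moreover have "\<not> ?e (h 2) (h 3) (h 4)"
      using h [of "{2, 3, 4}"] K4_minus_edges [of "{2, 3, 4}"] by (simp add: edge_rel_def)
    ultimately show False by (auto simp: edge_rel_four_partite)
  qed
qed

text \<open>Here \<open>r\<close> is the residue class that the edge misses, and \<open>i\<close>,
  \<open>j\<close>, \<open>k\<close> select its vertices in the other three classes.\<close>

lemma card_edges_four_partite: "4 * (n div 4) ^ 3 \<le> card (edges (four_partite n))"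
proof -
  let ?q = "n div 4"
  let ?D = "{..<4::nat} \<times> {..<?q} \<times> {..<?q} \<times> {..<?q}"
  let ?h = "\<lambda>(r, i, j, k). {4 * i + (r + 1) mod 4, 4 * j + (r + 2) mod 4, 4 * k + (r + 3) mod 4}"
  have four: "r = 0 \<or> r = 1 \<or> r = 2 \<or> r = 3" if "r < 4" for r :: nat using that by auto
  have quot_rem: "4 * m + s mod 4 = 4 * m' + s' mod 4 \<longleftrightarrow> m = m' \<and> s mod 4
    = s' mod 4" for m m' s s' :: nat
  proof -
    have "(4 * m + s mod 4) div 4 = m" "(4 * m + s mod 4) mod 4 = s mod 4" for m s :: nat
      by simp_all
    thus ?thesis by metis
  qed
  have inj: "inj_on ?h ?D"
  proof (rule inj_onI)
    fix p p' assume "p \<in> ?D" "p' \<in> ?D" and h: "?h p = ?h p'"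
    then obtain r i j k r' i' j' k' where p: "p = (r, i, j, k)" "p'
      = (r', i', j', k')" and r: "r < 4" "r' < 4"
      by auto
    let ?x = "4 * i + (r + 1) mod 4" and ?y = "4 * j + (r + 2) mod 4" and ?z = "4 * k
      + (r + 3) mod 4"
    let ?T = "{4 * i' + (r' + 1) mod 4, 4 * j' + (r' + 2) mod 4, 4 * k' + (r' + 3) mod 4}"
    have "{?x, ?y, ?z} = ?T" using h by (simp only: p prod.case)
    hence *: "?x \<in> ?T" "?y \<in> ?T" "?z \<in> ?T" by blast+
    \<comment> \<open>The residues present determine the missing class \<open>r\<close>; each
      residue then fixes its own quotient.\<close>
    have "r = r' \<and> i = i' \<and> j = j' \<and> k = k'"
      using four [OF r(1)] four [OF r(2)]
      by (elim disjE) (use * [unfolded insert_iff empty_iff quot_rem] in simp_all)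
    thus "p = p'" by (simp add: p)
  qed
  have "?h ` ?D \<subseteq> edges (four_partite n)"
  proof (rule image_subsetI)
    fix p assume "p \<in> ?D"
    then obtain r i j k where p: "p = (r, i, j, k)" and q: "i < ?q" "j < ?q" "k < ?q" by auto
    have lt: "4 * m + (r + s) mod 4 < n" if "m < ?q" for m s
    proof -
      have "4 * m + 4 \<le> 4 * ?q" using that by simp
      also have "\<dots> \<le> n" by simp
      finally show ?thesis using mod_less_divisor [of 4 "r + s"] by linarith
    qed
    have "(r + 1) mod 4 \<noteq> (r + 2) mod 4" "(r + 1) mod 4 \<noteq> (r + 3) mod 4" "(r + 2) mod 4 \<noteq> (r + 3)
      mod 4"
      by presburger+
    hence "edge_rel (four_partite n) (4 * i + (r + 1) mod 4) (4 * j + (r + 2) mod 4)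
      (4 * k + (r + 3) mod 4)"
      using lt [OF q(1), of 1] lt [OF q(2), of 2] lt [OF q(3), of 3]
        by (simp add: edge_rel_four_partite)
    thus "?h p \<in> edges (four_partite n)"
      by (simp add: edge_rel_def p)
  qed
  moreover have "finite (edges (four_partite n))"
    by (rule finite_subset [of _ "Pow {..<n}"]) (auto simp: four_partite_def)
  ultimately have "card (?h ` ?D) \<le> card (edges (four_partite n))"
    by (intro card_mono)
  thus ?thesis unfolding card_image [OF inj] by (simp add: power3_eq_cube)
qed

section \<open>The limit\<close>

lemma choose_three: "real (n choose 3) = real n * (real n - 1) * (real n - 2) / 6"
proof (induction n)
  case (Suc n)
  have "real (n choose 2) = real n * (real n - 1) / 2"
    by (cases n) (simp_all add: choose_two real_of_nat_div algebra_simps)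
  thus ?case using Suc by (simp add: numeral_3_eq_3 numeral_2_eq_2 field_simps)
qed (simp add: numeral_3_eq_3)

lemma max_edges_upper: "16 * max_edges n \<le> n ^ 3"
proof -
  have "max_edges n \<in> {card (edges G) | G :: nat hgraph. admissible G \<and> card (verts G) = n}"
    unfolding max_edges_def by (rule Max_in [OF finite_edge_counts edge_counts_nonempty])
  then obtain G :: "nat hgraph" where "max_edges n = card (edges G)" "admissible G" "card (verts G)
    = n"
    by blast
  thus ?thesis using admissible_card_edges [of G] by simp
qed

lemma max_edges_lower: "4 * (n div 4) ^ 3 \<le> max_edges n"
proof -
  have "card (verts (four_partite n)) = n" by (simp add: four_partite_def)
  hence "card (edges (four_partite n)) \<le> max_edges n"
    unfolding max_edges_def using four_partite_admissible
      by (intro Max_ge [OF finite_edge_counts]) blast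
  thus ?thesis using card_edges_four_partite le_trans by blast
qed

theorem theorem11:
  shows "(\<lambda>n. real (max_edges n) / real (n choose 3)) \<longlonglongrightarrow> 3 / 8"
proof (rule tendsto_sandwich)
  let ?c = "\<lambda>n. real n * (real n - 1) * (real n - 2) / 6"
  show "\<forall>\<^sub>F n in sequentially. (real n - 3) ^ 3 / 16 / ?c n
    \<le> real (max_edges n) / real (n choose 3)"
    using eventually_ge_at_top [of 4]
  proof eventually_elim
    case (elim n)
    \<comment> \<open>Rounding down to a multiple of 4 loses at most 3.\<close>
    have "real n - 3 \<le> 4 * real (n div 4)" by linarith
    hence "(real n - 3) ^ 3 \<le> (4 * real (n div 4)) ^ 3" using elim by (intro power_mono) auto
    also have "\<dots> = 16 * real (4 * (n div 4) ^ 3)" by (simp add: power_mult_distrib)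
    also have "real (4 * (n div 4) ^ 3) \<le> real (max_edges n)"
      using max_edges_lower [of n] by (simp only: of_nat_le_iff)
    finally have "(real n - 3) ^ 3 / 16 \<le> real (max_edges n)" by simp
    thus ?case unfolding choose_three using elim by (intro divide_right_mono) auto
  qed
  show "\<forall>\<^sub>F n in sequentially. real (max_edges n) / real (n choose 3) \<le> real n ^ 3 / 16 / ?c n"
    using eventually_ge_at_top [of 4]
  proof eventually_elim
    case (elim n)
    have "real (16 * max_edges n) \<le> real (n ^ 3)" using max_edges_upper [of n]
      by (simp only: of_nat_le_iff)
    hence "real (max_edges n) \<le> real n ^ 3 / 16" by simp
    thus ?case unfolding choose_three using elim by (intro divide_right_mono) auto
  qed
  \<comment> \<open>The leading coefficients give (1/16) / (1/6) = 3/8 in both bounds.\<close>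
  show "(\<lambda>n. (real n - 3) ^ 3 / 16 / ?c n) \<longlonglongrightarrow> 3 / 8" by real_asymp
  show "(\<lambda>n. real n ^ 3 / 16 / ?c n) \<longlonglongrightarrow> 3 / 8" by real_asymp
qed

end
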